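(* Let $R\in C^1([0,T]\to\mathrm{SO}(3))$, $t\mapsto R_t$, be continuously differentiable and let $t\in[0,T]$. Let $\boldsymbol\phi=(\phi_1,\phi_2)^\top\in\mathbb{S}^1_+$ be a unique direction in $\mathbb{S}^1_+$ with the property that there exist parameters $\rho,\zeta\in\mathbb{R}$ such that $$\partial_t\nu_t(r\boldsymbol\phi)=\left(\rho\left(k_0-\sqrt{k_0^2-r^2}\right)+r\zeta\right)\left\langle\nabla\nu_t(r\boldsymbol\phi),\begin{pmatrix}-\phi_2\\\phi_1\end{pmatrix}\right\rangle\quad\text{for all }r\in(-k_0,k_0).$$ Provided that the set $$\mathcal N_t=\left\{r\in(-k_0,k_0)\setminus\{0\}:\left\langle\nabla\nu_t(r\boldsymbol\phi),\begin{pmatrix}-\phi_2\\\phi_1\end{pmatrix}\right\rangle\neq0\right\}$$ contains at least two elements, the angular velocity of $R$ at time $t$ is given by $\boldsymbol\omega_t=(\rho\phi_1,\rho\phi_2,\zeta)^\top$.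
   Context: Fix $k_0>0$, $T>0$. $f\colon\mathbb{R}^3\to[0,\infty)$ is a piecewise continuous function supported in an open ball around $\boldsymbol 0$; $\mathcal{F}[f](\boldsymbol y)=(2\pi)^{-3/2}\int_{\mathbb{R}^3}f(\boldsymbol x)\,e^{-i\langle\boldsymbol x,\boldsymbol y\rangle}\,d\boldsymbol x$. The rotations satisfy $R_0=I$. For $\boldsymbol k\in\mathcal{B}^2_{k_0}=\{\boldsymbol k\in\mathbb{R}^2:\|\boldsymbol k\|<k_0\}$ let $\boldsymbol h(\boldsymbol k)=(k_1,k_2,\sqrt{k_0^2-\|\boldsymbol k\|^2}-k_0)^\top$ and $\nu_t(\boldsymbol k)=|\mathcal{F}[f](R_t\boldsymbol h(\boldsymbol k))|^2$. $\partial_t\nu_t$ is the partial derivative in $t$ (one-sided at the endpoints), $\nabla\nu_t$ the gradient with respect to $\boldsymbol k$. $\mathbb{S}^1_+=\{(\cos\alpha,\sin\alpha)^\top:\alpha\in[0,\pi)\}$. The angular velocity $\boldsymbol\omega_t\in\mathbb{R}^3$ is defined by $R_t^\top R_t'\boldsymbol y=\boldsymbol\omega_t\times\boldsymbol y$ for all $\boldsymbol y\in\mathbb{R}^3$, where $R_t'$ is the time derivative (it exists because $R_t^\top R_t'$ is skew-symmetric). *)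

theory Defs
  imports "HOL-Analysis.Analysis"
begin

(* The space is divided into finitely many open pieces, up to their Lebesgue null boundaries,
   and f extends continuously from each piece to its closure.  No condition is imposed on
   the values of f on the boundaries. *)
definition piecewise_continuous :: "('a::euclidean_space \<Rightarrow> real) \<Rightarrow> bool" where
  "piecewise_continuous f \<longleftrightarrow>
     (\<exists>\<U>. finite \<U> \<and> pairwise disjnt \<U> \<and> (\<Union>U\<in>\<U>. closure U) = UNIV \<and>
        (\<forall>U\<in>\<U>. open U \<and> negligible (frontier U) \<and>
           (\<exists>g. continuous_on (closure U) g \<and> (\<forall>x\<in>U. f x = g x))))"

(* The integral is over the completed measure: f may be arbitrary on the null boundaries
   of its pieces and hence fail to be Borel measurable. *)
definition fourier :: "(real^3 \<Rightarrow> real) \<Rightarrow> real^3 \<Rightarrow> complex" where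
  "fourier f y =
     of_real ((2 * pi) powr (-3/2)) *
     (LINT x|lebesgue. of_real (f x) * exp (- (\<i> * of_real (x \<bullet> y))))"

(* Meaningful for norm k < k0; sqrt is negative on negative arguments. *)
definition hemisphere :: "real \<Rightarrow> real^2 \<Rightarrow> real^3" where
  "hemisphere k0 k = vector [k $ 1, k $ 2, sqrt (k0\<^sup>2 - (norm k)\<^sup>2) - k0]"

definition nu :: "real \<Rightarrow> (real^3 \<Rightarrow> real) \<Rightarrow> (real \<Rightarrow> real^3^3) \<Rightarrow> real \<Rightarrow> real^2 \<Rightarrow> real" where
  "nu k0 f R t k = (cmod (fourier f (R t *v hemisphere k0 k)))\<^sup>2"

definition gradient :: "('a::real_inner \<Rightarrow> real) \<Rightarrow> 'a \<Rightarrow> 'a" where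
  "gradient g x = (THE D. GDERIV g x :> D)"

(* Derivatives on {0..T} are taken within the interval, i.e. one-sided at the endpoints;
   C1_differentiable_on would use the values of the path outside the interval. *)
definition C1_path_SO3 :: "real \<Rightarrow> (real \<Rightarrow> real^3^3) \<Rightarrow> bool" where
  "C1_path_SO3 T R \<longleftrightarrow>
     (\<forall>s\<in>{0..T}. rotation_matrix (R s)) \<and>
     (\<exists>R'. (\<forall>s\<in>{0..T}. (R has_vector_derivative R' s) (at s within {0..T})) \<and>
           continuous_on {0..T} R')"

definition angular_velocity :: "real \<Rightarrow> (real \<Rightarrow> real^3^3) \<Rightarrow> real \<Rightarrow> real^3" where
  "angular_velocity T R t =
     (THE w. \<forall>y. (transpose (R t) ** vector_derivative R (at t within {0..T})) *v y = cross3 w y)"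

definition half_circle :: "(real^2) set" where
  "half_circle = {vector [cos \<alpha>, sin \<alpha>] | \<alpha>. 0 \<le> \<alpha> \<and> \<alpha> < pi}"

definition normal_derivative ::
  "real \<Rightarrow> (real^3 \<Rightarrow> real) \<Rightarrow> (real \<Rightarrow> real^3^3) \<Rightarrow> real \<Rightarrow> real^2 \<Rightarrow> real \<Rightarrow> real" where
  "normal_derivative k0 f R t \<phi> r =
     gradient (nu k0 f R t) (r *\<^sub>R \<phi>) \<bullet> vector [- (\<phi> $ 2), \<phi> $ 1]"

definition common_circle_eq ::
  "real \<Rightarrow> real \<Rightarrow> (real^3 \<Rightarrow> real) \<Rightarrow> (real \<Rightarrow> real^3^3) \<Rightarrow> real \<Rightarrow> real^2 \<Rightarrow> real \<Rightarrow> real \<Rightarrow> bool" where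
  "common_circle_eq k0 T f R t \<phi> \<rho> \<zeta> \<longleftrightarrow>
     (\<forall>r\<in>{-k0<..<k0}.
        vector_derivative (\<lambda>s. nu k0 f R s (r *\<^sub>R \<phi>)) (at t within {0..T}) =
        (\<rho> * (k0 - sqrt (k0\<^sup>2 - r\<^sup>2)) + r * \<zeta>) * normal_derivative k0 f R t \<phi> r)"

end

theory Submission
  imports Defs
begin

text \<open>
  Let \<open>G y = \<bar>fourier f y\<bar>\<^sup>2\<close> and \<open>\<nu>\<^sub>t k = G (R\<^sub>t (h k))\<close>, where \<open>h\<close> parametrizes the
  hemisphere.  Everything rests on one computation.  Write the angular velocity in the form
  \<open>\<omega> = (\<rho> \<psi>\<^sub>1, \<rho> \<psi>\<^sub>2, \<zeta>)\<close> with \<open>\<psi>\<close> a unit vector of the plane.  On the circular arc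
  \<open>r \<mapsto> h (r \<psi>)\<close> the velocity field \<open>\<omega> \<times> h (r \<psi>)\<close> is
  \<open>\<rho> (k\<^sub>0 - \<surd>(k\<^sub>0\<^sup>2 - r\<^sup>2)) + r \<zeta>\<close> times the horizontal vector \<open>(-\<psi>\<^sub>2, \<psi>\<^sub>1, 0)\<close>,
  because both \<open>\<omega>\<close> and \<open>h (r \<psi>)\<close> lie in the vertical plane spanned by \<open>\<psi>\<close> and the third axis.
  That horizontal vector is also the derivative of \<open>h\<close> at \<open>r \<psi>\<close> in the direction
  \<open>(-\<psi>\<^sub>2, \<psi>\<^sub>1)\<close>, as \<open>\<bar>k\<bar>\<close> is stationary there.  By the chain rule, the time derivative of
  \<open>\<nu>\<close> at \<open>r \<psi>\<close> is therefore the same factor times the normal derivative of \<open>\<nu>\<^sub>t\<close>: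
  \<open>\<psi>\<close>, \<open>\<rho>\<close> and \<open>\<zeta>\<close> solve the equation of the common circle
  (\<open>common_circle_eq_angular_velocity\<close>).

  Polar coordinates with a signed radius put \<open>\<psi>\<close> into the half circle, so uniqueness of the
  direction forces \<open>\<psi> = \<phi>\<close>.  Now two pairs of parameters solve the equation for the same
  direction.  Wherever the normal derivative is nonzero, the difference of the pairs satisfies a
  homogeneous linear equation, and the equations for two distinct nonzero radii are linearly
  independent (\<open>circle_coefficients_eq_0\<close>), so the pairs agree.

  The chain rule needs \<open>G\<close> to be differentiable.  This follows from boundedness of the support of
  \<open>f\<close>, which gives the Fourier integral a first order Taylor expansion with quadratic remainder
  (\<open>fourier_has_derivative\<close>).
\<close>

section \<open>Smoothness of the Fourier transform\<close>

text \<open>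
  On each piece, \<open>f\<close> agrees inside a ball with a function that is continuous on a compact set; what
  is left over lies in the boundaries of the pieces, a null set.
\<close>

lemma integrable_piecewise_continuous:
  fixes f :: "'a::euclidean_space \<Rightarrow> real"
  assumes pc: "piecewise_continuous f" and supp: "\<And>x. f x \<noteq> 0 \<Longrightarrow> norm x \<le> b"
  shows "integrable lebesgue f"
proof -
  obtain \<U> where fin: "finite \<U>" and cover: "(\<Union>U\<in>\<U>. closure U) = UNIV"
    and op: "\<And>U. U \<in> \<U> \<Longrightarrow> open U" and fr: "\<And>U. U \<in> \<U> \<Longrightarrow> negligible (frontier U)"
    and ext: "\<And>U. U \<in> \<U> \<Longrightarrow> \<exists>g. continuous_on (closure U) g \<and> (\<forall>x\<in>U. f x = g x)"
    using pc unfolding piecewise_continuous_def by metis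
  have piece: "set_integrable lebesgue U f" if U: "U \<in> \<U>" for U
  proof -
    obtain g where g: "continuous_on (closure U) g" "\<And>x. x \<in> U \<Longrightarrow> f x = g x"
      using ext[OF U] by blast
    let ?K = "closure U \<inter> cball 0 b"
    have "integrable lborel (\<lambda>x. indicator ?K x *\<^sub>R g x)"
      by (rule borel_integrable_compact)
         (auto intro: continuous_on_subset[OF g(1)] compact_Int_closed simp: closed_Int_compact)
    then have "set_integrable lebesgue ?K g"
      unfolding set_integrable_def by (simp add: integrable_completion)
    then have "set_integrable lebesgue (U \<inter> cball 0 b) g"
      by (rule set_integrable_subset) (use op[OF U] closure_subset in \<open>auto intro!: sets.Int\<close>)
    \<comment> \<open>outside the ball \<open>f\<close> vanishes, which on \<open>U\<close> forces \<open>g\<close> to vanish too\<close>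
    moreover have "indicator (U \<inter> cball 0 b) x *\<^sub>R g x = indicator U x *\<^sub>R f x" for x
    proof (cases "x \<in> U \<and> f x \<noteq> 0")
      case True
      then show ?thesis using g(2)[of x] supp[of x] by (simp add: indicator_def)
    next
      case False
      then show ?thesis using g(2) by (auto simp: indicator_def)
    qed
    ultimately show ?thesis
      unfolding set_integrable_def by simp
  qed
  have int_pieces: "f absolutely_integrable_on (\<Union>U\<in>\<U>. U)"
    by (rule set_integrable_UN[OF fin piece]) (use op in auto)
  have "negligible (\<Union>U\<in>\<U>. frontier U)"
    using fin fr by (auto intro: negligible_Union)
  moreover have "UNIV - (\<Union>U\<in>\<U>. U) \<subseteq> (\<Union>U\<in>\<U>. frontier U)"
  proof
    fix x assume "x \<in> UNIV - (\<Union>U\<in>\<U>. U)"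
    moreover obtain U where "U \<in> \<U>" "x \<in> closure U" using cover by blast
    ultimately show "x \<in> (\<Union>U\<in>\<U>. frontier U)"
      using op by (auto simp: frontier_def interior_open)
  qed
  ultimately have neg: "negligible (UNIV - (\<Union>U\<in>\<U>. U))"
    by (rule negligible_subset)
  have "f absolutely_integrable_on UNIV"
    by (rule absolutely_integrable_spike_set[OF int_pieces])
       (auto intro: negligible_subset[OF neg])
  then show ?thesis
    by (simp add: set_integrable_def)
qed

text \<open>
  The candidate derivative is obtained by differentiating under the integral sign.  The Taylor
  estimate \<open>\<bar>exp z - 1 - z\<bar> \<le> \<bar>z\<bar>\<^sup>2\<close> for imaginary \<open>z\<close> bounds the integrand of the remainder
  by \<open>b\<^sup>2 \<bar>h\<bar>\<^sup>2 \<bar>f x\<bar>\<close>, since \<open>\<bar>x\<bar> \<le> b\<close> where \<open>f\<close> does not vanish.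
\<close>

lemma fourier_has_derivative:
  assumes int: "integrable lebesgue f" and supp: "\<And>x. f x \<noteq> 0 \<Longrightarrow> norm x \<le> b"
  shows "\<exists>D. (fourier f has_derivative D) (at y)"
proof -
  define c :: complex where "c = of_real ((2 * pi) powr (-3/2))"
  define E where "E x y = exp (- (\<i> * of_real (x \<bullet> y)))" for x y :: "real^3"
  define D where "D h = c * (LINT x|lebesgue. of_real (f x) * (- (\<i> * of_real (x \<bullet> h)) * E x y))" for h
  have fE: "fourier f y = c * (LINT x|lebesgue. of_real (f x) * E x y)" for y
    by (simp add: fourier_def c_def E_def)
  have normE: "norm (E x y) = 1" for x y
    by (simp add: E_def)
  have dom: "integrable lebesgue (\<lambda>x. of_real (f x) * g x :: complex)"
    if g: "continuous_on UNIV g" and bd: "\<And>x. norm x \<le> b \<Longrightarrow> norm (g x) \<le> B" for g B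
  proof (rule Bochner_Integration.integrable_bound)
    show "integrable lebesgue (\<lambda>x. B * f x)" using int by simp
    have "g \<in> borel_measurable lebesgue"
      using borel_measurable_continuous_onI[OF g] by (simp add: measurable_completion)
    then show "(\<lambda>x. of_real (f x) * g x) \<in> borel_measurable lebesgue"
      using borel_measurable_integrable[OF int] by measurable
    have "norm (of_real (f x) * g x) \<le> norm (B * f x)" for x
      using bd[of x] supp[of x]
      by (cases "f x = 0") (auto simp: norm_mult abs_mult mult.commute intro!: mult_left_mono)
    then show "AE x in lebesgue. norm (of_real (f x) * g x) \<le> norm (B * f x)" by simp
  qed
  have contE: "continuous_on UNIV (\<lambda>x. E x y)" for y
    unfolding E_def by (intro continuous_intros)
  have intE: "integrable lebesgue (\<lambda>x. of_real (f x) * E x y)" for y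
    by (rule dom[where B = 1]) (use contE normE in auto)
  have intD: "integrable lebesgue (\<lambda>x. of_real (f x) * (- (\<i> * of_real (x \<bullet> h)) * E x y))" for h y
  proof (rule dom[where B = "b * norm h"])
    show "continuous_on UNIV (\<lambda>x. - (\<i> * of_real (x \<bullet> h)) * E x y)"
      by (intro continuous_intros contE)
    show "norm (- (\<i> * of_real (x \<bullet> h)) * E x y) \<le> b * norm h" if "norm x \<le> b" for x
      using order_trans[OF Cauchy_Schwarz_ineq2[of x h] mult_right_mono[OF that norm_ge_zero[of h]]]
      by (simp add: norm_mult normE)
  qed
  have "linear D"
  proof
    show "D (u + v) = D u + D v" for u v
      unfolding D_def
      by (subst distrib_left[symmetric], subst Bochner_Integration.integral_add[symmetric])
         (use intD in \<open>simp_all add: algebra_simps\<close>)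
    show "D (r *\<^sub>R u) = r *\<^sub>R D u" for r u
    proof -
      have "(\<lambda>x. of_real (f x) * (- (\<i> * of_real (x \<bullet> (r *\<^sub>R u))) * E x y))
          = (\<lambda>x. of_real r * (of_real (f x) * (- (\<i> * of_real (x \<bullet> u)) * E x y)))"
        by (simp add: algebra_simps)
      then show ?thesis
        by (simp only: D_def integral_mult_right_zero scaleR_conv_of_real mult.left_commute)
    qed
  qed
  define C where "C = norm c * (b\<^sup>2 * (LINT x|lebesgue. \<bar>f x\<bar>))"
  have rem: "norm (fourier f (y + h) - fourier f y - D h) \<le> C * (norm h)\<^sup>2" for h
  proof -
    let ?g = "\<lambda>x. of_real (f x) * E x (y + h) - of_real (f x) * E x y
                  - of_real (f x) * (- (\<i> * of_real (x \<bullet> h)) * E x y)"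
    have "fourier f (y + h) - fourier f y - D h = c * (LINT x|lebesgue. ?g x)"
      unfolding fE D_def using intE intD
      by (simp only: Bochner_Integration.integral_diff Bochner_Integration.integrable_diff right_diff_distrib)
    also have "norm \<dots> \<le> norm c * (LINT x|lebesgue. (b\<^sup>2 * (norm h)\<^sup>2) * \<bar>f x\<bar>)"
    proof -
      have "norm (?g x) \<le> (b\<^sup>2 * (norm h)\<^sup>2) * \<bar>f x\<bar>" for x
      proof (cases "f x = 0")
        case False
        define z where "z = - (\<i> * of_real (x \<bullet> h))"
        have "?g x = of_real (f x) * (E x y * (exp z - (1 + z)))"
          unfolding E_def z_def by (simp add: inner_add_right exp_add [symmetric] algebra_simps)
        then have "norm (?g x) = \<bar>f x\<bar> * norm (exp z - (1 + z))"
          by (simp add: norm_mult normE)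
        also have "norm (exp z - (1 + z)) \<le> (norm z)\<^sup>2"
          using Taylor_exp[of z 1] by (simp add: z_def power2_eq_square)
        also have "norm z = \<bar>x \<bullet> h\<bar>" by (simp add: z_def norm_mult)
        also have "\<bar>x \<bullet> h\<bar>\<^sup>2 \<le> (b * norm h)\<^sup>2"
          using order_trans[OF Cauchy_Schwarz_ineq2[of x h]
              mult_right_mono[OF supp[OF False] norm_ge_zero[of h]]]
          by (intro power_mono) auto
        finally have "norm (?g x) \<le> \<bar>f x\<bar> * (b * norm h)\<^sup>2"
          by (simp add: mult_left_mono)
        then show ?thesis by (simp add: power_mult_distrib mult.commute)
      qed simp
      then have "norm (LINT x|lebesgue. ?g x) \<le> (LINT x|lebesgue. (b\<^sup>2 * (norm h)\<^sup>2) * \<bar>f x\<bar>)"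
        using intE intD int
        by (intro Bochner_Integration.integral_norm_bound_integral) (auto intro!: Bochner_Integration.integrable_diff)
      then show ?thesis by (simp only: norm_mult mult_left_mono norm_ge_zero)
    qed
    also have "\<dots> = C * (norm h)\<^sup>2" by (simp add: C_def)
    finally show ?thesis .
  qed
  have "(fourier f has_derivative D) (at y)"
    unfolding has_derivative_at
  proof
    show "bounded_linear D" using \<open>linear D\<close> by (simp add: linear_conv_bounded_linear)
    have "((\<lambda>h::real^3. C * norm h) \<longlongrightarrow> 0) (at 0)"
      by (auto intro!: tendsto_eq_intros)
    moreover have "\<forall>\<^sub>F h in at 0. norm (norm (fourier f (y + h) - fourier f y - D h) / norm h) \<le> C * norm h"
      unfolding eventually_at_topological
      using rem by (auto intro!: exI[of _ UNIV] simp: divide_le_eq power2_eq_square mult.assoc)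
    ultimately show "((\<lambda>h. norm (fourier f (y + h) - fourier f y - D h) / norm h) \<longlongrightarrow> 0) (at 0)"
      by (rule Lim_null_comparison[rotated])
  qed
  then show ?thesis by blast
qed

lemma cmod_fourier_power2_has_derivative:
  assumes "integrable lebesgue f" and "\<And>x. f x \<noteq> 0 \<Longrightarrow> norm x \<le> b"
  obtains D where "((\<lambda>y. (cmod (fourier f y))\<^sup>2) has_derivative D) (at y)"
proof -
  obtain D where "(fourier f has_derivative D) (at y)"
    using fourier_has_derivative[OF assms] by blast
  then show thesis
    using that has_derivative_inner unfolding power2_norm_eq_inner by blast
qed

section \<open>Derivatives along the hemisphere and along the path of rotations\<close>

text \<open>
  The gradient is a definite description, so its value is only known once the Riesz representative of
  the derivative is shown to exist and to be unique.
\<close>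

lemma gradient_inner:
  fixes g :: "'a::euclidean_space \<Rightarrow> real"
  assumes g: "(g has_derivative g') (at x)"
  shows "gradient g x \<bullet> v = g' v"
proof -
  let ?D = "\<Sum>b\<in>Basis. g' b *\<^sub>R b"
  have rep: "g' h = h \<bullet> ?D" for h
  proof -
    interpret linear g' using g has_derivative_linear by blast
    have "g' h = g' (\<Sum>b\<in>Basis. (h \<bullet> b) *\<^sub>R b)" by (simp add: euclidean_representation)
    also have "\<dots> = h \<bullet> ?D" by (simp add: sum scaleR inner_sum_right mult.commute)
    finally show ?thesis .
  qed
  have "g' = (\<lambda>h. h \<bullet> ?D)" using rep by (rule ext)
  then have D: "GDERIV g x :> ?D" unfolding gderiv_def using g by (simp only:)
  have "D = ?D" if "GDERIV g x :> D" for D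
  proof -
    have "(\<lambda>h. h \<bullet> D) = (\<lambda>h. h \<bullet> ?D)"
      using has_derivative_unique that D unfolding gderiv_def by blast
    then show ?thesis by (metis vector_eq_ldot)
  qed
  then have "gradient g x = ?D" unfolding gradient_def using D by blast
  then show ?thesis unfolding rep[of v] by (metis inner_commute)
qed

lemma hemisphere_has_derivative:
  assumes k: "norm k < k0"
  shows "(hemisphere k0 has_derivative
           (\<lambda>v. vector [v $ 1, v $ 2, - (k \<bullet> v) / sqrt (k0\<^sup>2 - (norm k)\<^sup>2)])) (at k)"
proof -
  have pos: "0 < k0\<^sup>2 - (norm k)\<^sup>2"
    using k by (simp add: power_strict_mono)
  have vec: "vector [a, b, c] = a *\<^sub>R axis 1 1 + b *\<^sub>R axis 2 1 + c *\<^sub>R (axis 3 1 :: real^3)" for a b c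
    by (simp add: vec_eq_iff forall_3 axis_def)
  have sq: "((\<lambda>k. sqrt (k0\<^sup>2 - (norm k)\<^sup>2) - k0) has_derivative
          (\<lambda>v. - (k \<bullet> v) / sqrt (k0\<^sup>2 - (norm k)\<^sup>2))) (at k)"
    unfolding power2_norm_eq_inner
    using pos[unfolded power2_norm_eq_inner]
    by (auto intro!: derivative_eq_intros simp: inner_commute field_simps)
  show ?thesis
    unfolding hemisphere_def vec
    by (intro has_derivative_add has_derivative_scaleR_left sq
          bounded_linear_imp_has_derivative bounded_linear_vec_nth)
qed

lemma matrix_path_vector_has_derivative:
  fixes R :: "real \<Rightarrow> real^'n^'m"
  assumes "(R has_vector_derivative R') F"
  shows "((\<lambda>s. R s *v y) has_vector_derivative R' *v y) F"
proof -
  have "linear (\<lambda>A :: real^'n^'m. A *v y)"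
    by (rule linearI) (simp_all add: matrix_vector_mult_add_rdistrib scaleR_matrix_vector_assoc)
  then have "bounded_linear (\<lambda>A :: real^'n^'m. A *v y)" by (simp add: linear_conv_bounded_linear)
  from bounded_linear.has_vector_derivative[OF this assms] show ?thesis .
qed

lemma rotation_matrix_mult_transpose:
  assumes "rotation_matrix Q"
  shows "Q ** transpose Q = mat 1"
  using assms by (auto simp: rotation_matrix_def orthogonal_matrix_def)

section \<open>Angular velocity\<close>

text \<open>The cross product with \<open>w\<close> has exactly the entries of a general skew matrix.\<close>

lemma skew_matrix_eq_cross3:
  fixes A :: "real^3^3"
  assumes skew: "transpose A = - A"
  shows "A *v y = cross3 (vector [A $ 3 $ 2, A $ 1 $ 3, A $ 2 $ 1]) y"
proof -
  have e: "A $ j $ i = - A $ i $ j" for i j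
    using arg_cong[OF skew, of "\<lambda>B. B $ i $ j"] by (simp add: transpose_def)
  have "A $ i $ i = 0" for i using e[of i i] by simp
  with e[of 1 2] e[of 2 3] e[of 3 1] show ?thesis
    by (simp add: vec_eq_iff forall_3 matrix_vector_mult_def sum_3 cross3_def algebra_simps)
qed

lemma cross3_left_cancel:
  assumes "\<And>y. cross3 w y = cross3 w' y"
  shows "w = w'"
proof -
  \<comment> \<open>each of these two products misses one component of \<open>w\<close>, and not the same one\<close>
  have "cross3 w (axis 1 1) = cross3 w' (axis 1 1)" "cross3 w (axis 2 1) = cross3 w' (axis 2 1)"
    using assms by blast+
  then show ?thesis by (simp add: vec_eq_iff forall_3 cross3_def axis_def)
qed

text \<open>
  Differentiate the constant function \<open>\<lambda>s. (R s *v u) \<bullet> (R s *v v)\<close>.  The derivative is taken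
  within the interval, so the endpoints are covered.
\<close>

lemma orthogonal_path_skew:
  fixes R :: "real \<Rightarrow> real^'n^'n"
  assumes T: "0 < T" "t \<in> {0..T}" and rot: "\<And>s. s \<in> {0..T} \<Longrightarrow> orthogonal_matrix (R s)"
    and R': "(R has_vector_derivative R') (at t within {0..T})"
  shows "transpose (transpose (R t) ** R') = - (transpose (R t) ** R')"
proof -
  let ?A = "transpose (R t) ** R'"
  have adj: "(R t *v u) \<bullet> (R' *v v) = u \<bullet> (?A *v v)" for u v
    by (metis dot_lmul_matrix matrix_vector_mul_assoc transpose_matrix_vector transpose_transpose)
  have const: "(R s *v u) \<bullet> (R s *v v) = u \<bullet> v" if "s \<in> {0..T}" for s u v
    using rot[OF that] unfolding orthogonal_matrix_def
    by (metis dot_lmul_matrix matrix_vector_mul_assoc matrix_vector_mul_lid transpose_matrix_vector transpose_transpose)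
  have "u \<bullet> (?A *v v) + v \<bullet> (?A *v u) = 0" for u v
  proof -
    have "((\<lambda>s. (R s *v u) \<bullet> (R s *v v)) has_vector_derivative
            (R t *v u) \<bullet> (R' *v v) + (R' *v u) \<bullet> (R t *v v)) (at t within {0..T})"
      by (intro bounded_bilinear.has_vector_derivative[OF bounded_bilinear_inner]
            matrix_path_vector_has_derivative R')
    moreover have "((\<lambda>s. (R s *v u) \<bullet> (R s *v v)) has_vector_derivative 0) (at t within {0..T})"
      by (rule has_vector_derivative_transform[OF T(2) _ has_vector_derivative_const[of "u \<bullet> v"]])
         (simp add: const)
    ultimately have "(R t *v u) \<bullet> (R' *v v) + (R' *v u) \<bullet> (R t *v v) = 0"
      by (blast dest: vector_derivative_within_closed_interval[OF T] intro: trans[OF sym])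
    then show ?thesis by (simp add: adj inner_commute[of "R' *v u"])
  qed
  moreover have "axis i 1 \<bullet> (?A *v axis j 1) = ?A $ i $ j" for i j
    by (simp add: inner_axis' matrix_vector_mul_component inner_axis)
  ultimately have "?A $ i $ j + ?A $ j $ i = 0" for i j by metis
  then show ?thesis
    by (simp add: vec_eq_iff transpose_def eq_neg_iff_add_eq_0)
qed

text \<open>
  The description that defines the angular velocity is resolved here, and the defining equation is
  multiplied by \<open>R t\<close> to give the derivative of the path itself.
\<close>

lemma angular_velocity_cross3:
  assumes path: "C1_path_SO3 T R" and T: "0 < T" "t \<in> {0..T}"
  obtains R' where "(R has_vector_derivative R') (at t within {0..T})"
    "\<And>y. R' *v y = R t *v cross3 (angular_velocity T R t) y"
proof -
  have rot: "rotation_matrix (R s)" if "s \<in> {0..T}" for s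
    using path that by (auto simp: C1_path_SO3_def)
  obtain R' where R': "(R has_vector_derivative R') (at t within {0..T})"
    using path T(2) unfolding C1_path_SO3_def by blast
  let ?A = "transpose (R t) ** R'"
  have vd: "vector_derivative R (at t within {0..T}) = R'"
    using vector_derivative_within_closed_interval[OF T R'] .
  have "transpose ?A = - ?A"
    using orthogonal_path_skew[OF T _ R'] rot by (simp add: rotation_matrix_def)
  from skew_matrix_eq_cross3[OF this] obtain w where w: "\<forall>y. ?A *v y = cross3 w y"
    by blast
  have "angular_velocity T R t = w"
    unfolding angular_velocity_def vd
    by (rule the_equality[where a = w]) (use w cross3_left_cancel in metis)+
  with w have "R' *v y = R t *v cross3 (angular_velocity T R t) y" for y
    using rotation_matrix_mult_transpose[OF rot[OF T(2)]]
    by (metis matrix_vector_mul_assoc matrix_mul_assoc matrix_mul_lid)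
  with R' show thesis by (rule that)
qed

section \<open>Recovering the angular velocity from the common circle\<close>

text \<open>
  Polar coordinates in which the angle is confined to \<open>[0, pi)\<close> and the radius may be negative: an
  angle in \<open>[pi, 2 * pi)\<close> is reduced by \<open>pi\<close> at the cost of the sign of the radius.
\<close>

lemma half_circle_polar:
  fixes a b :: real
  obtains \<psi> \<rho> where "\<psi> \<in> half_circle" "a = \<rho> * \<psi> $ 1" "b = \<rho> * \<psi> $ 2"
proof -
  obtain r \<alpha> where "Complex a b = of_real r * cis \<alpha>" "0 \<le> \<alpha>" "\<alpha> < pi"
  proof -
    let ?z = "Complex a b"
    have z: "?z = of_real (cmod ?z) * cis (Arg2pi ?z)"
      using Arg2pi_eq[of ?z] by (simp add: cis_conv_exp)
    show thesis
    proof (cases "Arg2pi ?z < pi")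
      case True
      with z Arg2pi_ge_0 show ?thesis by (intro that[of "cmod ?z" "Arg2pi ?z"])
    next
      case False
      have "?z = of_real (- cmod ?z) * cis (Arg2pi ?z - pi)"
        by (subst z) (simp add: complex_eq_iff)
      with False Arg2pi_lt_2pi[of ?z] show ?thesis
        by (intro that[of "- cmod ?z" "Arg2pi ?z - pi"]) auto
    qed
  qed
  then have "a = r * cos \<alpha>" "b = r * sin \<alpha>" "vector [cos \<alpha>, sin \<alpha>] \<in> half_circle"
    by (auto simp: complex_eq_iff half_circle_def)
  then show thesis
    by (intro that[of "vector [cos \<alpha>, sin \<alpha>]" r]) auto
qed

lemma half_circle_norm:
  assumes "\<psi> \<in> half_circle"
  shows "norm \<psi> = 1"
  using assms by (auto simp: half_circle_def norm_eq_1 inner_vec_def sum_2)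

text \<open>
  The angular velocity always solves the equation of the common circle: \<open>\<omega> \<times> h\<close> and the normal
  derivative of the hemisphere are parallel along the arc of direction \<open>\<psi>\<close>, and the derivative
  of the squared modulus of the Fourier transform is linear.
\<close>

lemma common_circle_eq_angular_velocity:
  assumes T: "0 < T" "t \<in> {0..T}" and path: "C1_path_SO3 T R"
    and f: "integrable lebesgue f" "\<And>x. f x \<noteq> 0 \<Longrightarrow> norm x \<le> b"
    and \<psi>: "norm \<psi> = 1"
    and w: "angular_velocity T R t = vector [\<rho> * \<psi> $ 1, \<rho> * \<psi> $ 2, \<zeta>]"
  shows "common_circle_eq k0 T f R t \<psi> \<rho> \<zeta>"
  unfolding common_circle_eq_def
proof
  fix r assume r: "r \<in> {-k0<..<k0}"
  define G where "G y = (cmod (fourier f y))\<^sup>2" for y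
  define h where "h = hemisphere k0 (r *\<^sub>R \<psi>)"
  define n :: "real^2" where "n = vector [- (\<psi> $ 2), \<psi> $ 1]"
  define n' :: "real^3" where "n' = vector [- (\<psi> $ 2), \<psi> $ 1, 0]"
  define c where "c = \<rho> * (k0 - sqrt (k0\<^sup>2 - r\<^sup>2)) + r * \<zeta>"
  obtain R' where R': "(R has_vector_derivative R') (at t within {0..T})"
    "\<And>y. R' *v y = R t *v cross3 (angular_velocity T R t) y"
    using angular_velocity_cross3[OF path T] by metis
  obtain G' where G': "(G has_derivative G') (at (R t *v h))"
    unfolding G_def using cmod_fourier_power2_has_derivative[OF f] .
  have nr: "norm (r *\<^sub>R \<psi>) = \<bar>r\<bar>" "norm (r *\<^sub>R \<psi>) < k0"
    using r \<psi> by auto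
  have cross: "cross3 (angular_velocity T R t) h = c *\<^sub>R n'"
    unfolding w h_def n'_def c_def hemisphere_def nr
    by (simp add: vec_eq_iff forall_3 cross3_def algebra_simps)
  have "((G \<circ> (\<lambda>s. R s *v h)) has_vector_derivative G' (R' *v h)) (at t within {0..T})"
    by (rule vector_derivative_diff_chain_within[OF matrix_path_vector_has_derivative[OF R'(1)]
          has_derivative_at_withinI[OF G']])
  then have "vector_derivative (\<lambda>s. nu k0 f R s (r *\<^sub>R \<psi>)) (at t within {0..T}) = G' (R' *v h)"
    using vector_derivative_within_closed_interval[OF T] by (simp add: nu_def o_def G_def h_def)
  also have "\<dots> = c * G' (R t *v n')"
    using has_derivative_linear[OF G']
    by (simp add: R'(2) cross matrix_vector_mult_scaleR linear_scale)
  also have "G' (R t *v n') = normal_derivative k0 f R t \<psi> r"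
  proof -
    let ?H = "\<lambda>v. vector [v $ 1, v $ 2, - (r *\<^sub>R \<psi> \<bullet> v) / sqrt (k0\<^sup>2 - (norm (r *\<^sub>R \<psi>))\<^sup>2)]"
    have "(nu k0 f R t has_derivative (\<lambda>v. G' (R t *v ?H v))) (at (r *\<^sub>R \<psi>))"
    proof -
      have "((\<lambda>k. R t *v hemisphere k0 k) has_derivative (\<lambda>v. R t *v ?H v)) (at (r *\<^sub>R \<psi>))"
        by (rule bounded_linear.has_derivative[OF matrix_vector_mul_bounded_linear
              hemisphere_has_derivative[OF nr(2)]])
      from has_derivative_compose[OF this, of G G'] G' show ?thesis
        by (simp add: nu_def[abs_def] G_def h_def)
    qed
    then have "normal_derivative k0 f R t \<psi> r = G' (R t *v ?H n)"
      unfolding normal_derivative_def n_def by (rule gradient_inner)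
    \<comment> \<open>the third component vanishes because \<open>n\<close> is orthogonal to \<open>\<psi>\<close>\<close>
    moreover have "?H n = n'"
      by (simp add: n_def n'_def inner_vec_def sum_2)
    ultimately show ?thesis by simp
  qed
  finally show "vector_derivative (\<lambda>s. nu k0 f R s (r *\<^sub>R \<psi>)) (at t within {0..T}) =
      (\<rho> * (k0 - sqrt (k0\<^sup>2 - r\<^sup>2)) + r * \<zeta>) * normal_derivative k0 f R t \<psi> r"
    by (simp add: c_def)
qed

text \<open>
  With \<open>r = k\<^sub>0 sin \<theta>\<close>, the ratio of the two coefficients is \<open>tan (\<theta> / 2)\<close>, which determines
  \<open>r\<close>; hence two radii give independent equations.  The proof calls the ratio \<open>u\<close> and uses the
  half-angle formula \<open>r (1 + u\<^sup>2) = 2 k\<^sub>0 u\<close> in place of the angle.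
\<close>

lemma circle_coefficients_eq_0:
  fixes k0 \<rho> \<zeta> :: real
  assumes r: "r1 \<in> {-k0<..<k0} - {0}" "r2 \<in> {-k0<..<k0} - {0}" "r1 \<noteq> r2"
    and eq: "\<rho> * (k0 - sqrt (k0\<^sup>2 - r1\<^sup>2)) + r1 * \<zeta> = 0" "\<rho> * (k0 - sqrt (k0\<^sup>2 - r2\<^sup>2)) + r2 * \<zeta> = 0"
  shows "\<rho> = 0" "\<zeta> = 0"
proof -
  define u where "u r = (k0 - sqrt (k0\<^sup>2 - r\<^sup>2)) / r" for r
  have u: "u r * r = k0 - sqrt (k0\<^sup>2 - r\<^sup>2)" "r * (1 + (u r)\<^sup>2) = 2 * k0 * u r"
    if "r \<in> {-k0<..<k0} - {0}" for r
  proof -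
    have r0: "r \<noteq> 0" "r\<^sup>2 \<le> k0\<^sup>2" using that by (auto simp: abs_le_square_iff[symmetric])
    show ur: "u r * r = k0 - sqrt (k0\<^sup>2 - r\<^sup>2)" using r0 by (simp add: u_def)
    have "(k0 - u r * r)\<^sup>2 = k0\<^sup>2 - r\<^sup>2" using r0 by (simp add: ur)
    then have "r * (r * (1 + (u r)\<^sup>2)) = r * (2 * k0 * u r)"
      by (simp add: power2_eq_square algebra_simps)
    then show "r * (1 + (u r)\<^sup>2) = 2 * k0 * u r" using r0 by simp
  qed
  have "u r1 \<noteq> u r2"
  proof
    assume "u r1 = u r2"
    then have "r1 * (1 + (u r2)\<^sup>2) = r2 * (1 + (u r2)\<^sup>2)" using u(2)[OF r(1)] u(2)[OF r(2)] by simp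
    moreover have "1 + (u r2)\<^sup>2 \<noteq> 0" by (smt (verit) zero_le_power2)
    ultimately show False using r(3) by simp
  qed
  have lin: "\<rho> * u r + \<zeta> = 0"
    if "r \<in> {-k0<..<k0} - {0}" "\<rho> * (k0 - sqrt (k0\<^sup>2 - r\<^sup>2)) + r * \<zeta> = 0" for r
  proof -
    have "r * (\<rho> * u r + \<zeta>) = \<rho> * (u r * r) + r * \<zeta>" by (simp add: algebra_simps)
    also have "\<dots> = 0" by (simp only: u(1)[OF that(1)] that(2))
    finally show ?thesis using that(1) by (simp only: mult_eq_0_iff) blast
  qed
  have "\<rho> * u r1 = \<rho> * u r2"
    using lin[OF r(1) eq(1)] lin[OF r(2) eq(2)] by linarith
  then show "\<rho> = 0" using \<open>u r1 \<noteq> u r2\<close> by simp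
  then show "\<zeta> = 0" using lin[OF r(1) eq(1)] by simp
qed

theorem theorem4p2:
  fixes k0 T t \<rho> \<zeta> :: real
    and f :: "real^3 \<Rightarrow> real"
    and R :: "real \<Rightarrow> real^3^3"
    and \<phi> :: "real^2"
  assumes "k0 > 0" and "T > 0"
    and "\<And>x. f x \<ge> 0"
    and "piecewise_continuous f"
    and "\<exists>b>0. closure {x. f x \<noteq> 0} \<subseteq> ball 0 b"
    and "C1_path_SO3 T R" and "R 0 = mat 1"
    and "t \<in> {0..T}"
    and "\<exists>!\<psi>. \<psi> \<in> half_circle \<and> (\<exists>\<rho>' \<zeta>'. common_circle_eq k0 T f R t \<psi> \<rho>' \<zeta>')"
    and "\<phi> \<in> half_circle"
    and "common_circle_eq k0 T f R t \<phi> \<rho> \<zeta>"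
    and "\<exists>r1 r2. r1 \<noteq> r2 \<and>
           {r1, r2} \<subseteq> {r \<in> {-k0<..<k0} - {0}. normal_derivative k0 f R t \<phi> r \<noteq> 0}"
  shows "angular_velocity T R t = vector [\<rho> * \<phi> $ 1, \<rho> * \<phi> $ 2, \<zeta>]"
proof -
  obtain b where b: "closure {x. f x \<noteq> 0} \<subseteq> ball 0 b" using assms(5) by blast
  have supp: "norm x \<le> b" if "f x \<noteq> 0" for x
    using that b closure_subset[of "{x. f x \<noteq> 0}"] by (force simp: subset_iff)
  have f: "integrable lebesgue f"
    using integrable_piecewise_continuous[OF assms(4)] supp by blast
  define w where "w = angular_velocity T R t"
  obtain \<psi> \<rho>' where \<psi>: "\<psi> \<in> half_circle" "w $ 1 = \<rho>' * \<psi> $ 1" "w $ 2 = \<rho>' * \<psi> $ 2"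
    using half_circle_polar by metis
  have w: "w = vector [\<rho>' * \<psi> $ 1, \<rho>' * \<psi> $ 2, w $ 3]"
    using \<psi> by (simp add: vec_eq_iff forall_3)
  have circ: "common_circle_eq k0 T f R t \<psi> \<rho>' (w $ 3)"
  proof (rule common_circle_eq_angular_velocity[OF assms(2,8,6) f supp half_circle_norm[OF \<psi>(1)]])
    show "angular_velocity T R t = vector [\<rho>' * \<psi> $ 1, \<rho>' * \<psi> $ 2, w $ 3]"
      using w unfolding w_def .
  qed
  have "\<psi> = \<phi>" using assms(9-11) \<psi>(1) circ by blast
  obtain r1 r2 where r: "r1 \<in> {-k0<..<k0} - {0}" "r2 \<in> {-k0<..<k0} - {0}" "r1 \<noteq> r2"
    "normal_derivative k0 f R t \<phi> r1 \<noteq> 0" "normal_derivative k0 f R t \<phi> r2 \<noteq> 0"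
    using assms(12) by blast
  have coeffs: "(\<rho>' - \<rho>) * (k0 - sqrt (k0\<^sup>2 - r\<^sup>2)) + r * (w $ 3 - \<zeta>) = 0"
    if "r \<in> {-k0<..<k0} - {0}" "normal_derivative k0 f R t \<phi> r \<noteq> 0" for r
  proof -
    have "(\<rho>' * (k0 - sqrt (k0\<^sup>2 - r\<^sup>2)) + r * w $ 3) * normal_derivative k0 f R t \<phi> r
        = (\<rho> * (k0 - sqrt (k0\<^sup>2 - r\<^sup>2)) + r * \<zeta>) * normal_derivative k0 f R t \<phi> r"
      using circ assms(11) that(1) unfolding \<open>\<psi> = \<phi>\<close> common_circle_eq_def by (metis DiffD1)
    then have "\<rho>' * (k0 - sqrt (k0\<^sup>2 - r\<^sup>2)) + r * w $ 3 = \<rho> * (k0 - sqrt (k0\<^sup>2 - r\<^sup>2)) + r * \<zeta>"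
      using that(2) by simp
    then show ?thesis by (simp add: left_diff_distrib right_diff_distrib)
  qed
  have "\<rho>' - \<rho> = 0" "w $ 3 - \<zeta> = 0"
    using circle_coefficients_eq_0[OF r(1-3) coeffs[OF r(1,4)] coeffs[OF r(2,5)]] .
  then show ?thesis
    using \<psi>(2,3) \<open>\<psi> = \<phi>\<close> by (simp add: vec_eq_iff forall_3 flip: w_def)
qed

end
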